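(* Let $A_1,A_2$ be two points in the projective plane, let $a=A_1\times A_2$, and for $i\in\{1,2\}$ let $(a\,a_i;b_{i1}b_{i2})$ be a harmonic pencil of lines at the point $A_i$. Then each of the following two triples of points is collinear: $$a_1\times a_2,\quad b_{11}\times b_{21},\quad b_{12}\times b_{22};$$ $$a_1\times a_2,\quad b_{11}\times b_{22},\quad b_{12}\times b_{21}.$$
   Context: The setting is the real projective plane. For distinct points $A,B$, $A\times B$ is the line through $A$ and $B$; for distinct lines $g,h$, $g\times h$ is their intersection point. A harmonic pencil $(gh;uv)$ at a point $A$ consists of four distinct lines $g,h,u,v$ through $A$ such that $v$ is the harmonic conjugate of $u$ with respect to $g$ and $h$ (cross-ratio $-1$ in the classical normalization). *)

theory Defs
  imports "HOL-Analysis.Analysis"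
begin

section \<open>The real projective plane\<close>

definition proportional :: "real^3 \<Rightarrow> real^3 \<Rightarrow> bool" where
  "proportional x y \<longleftrightarrow> x \<noteq> 0 \<and> y \<noteq> 0 \<and> (\<exists>c. x = c *\<^sub>R y)"

lemma proportional_iff:
  "proportional x y \<longleftrightarrow> y \<noteq> 0 \<and> (\<exists>c. c \<noteq> 0 \<and> x = c *\<^sub>R y)"
  unfolding proportional_def by auto

lemma proportional_refl [simp]: "proportional x x \<longleftrightarrow> x \<noteq> 0"
  by (auto simp: proportional_def intro: exI[of _ 1])

lemma part_equivp_proportional: "part_equivp proportional"
proof (rule part_equivpI)
  show "\<exists>x. proportional x x"
    by (rule exI[of _ "axis 1 1"]) simp
  show "symp proportional"
  proof (rule sympI)
    fix x y assume "proportional x y"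
    then obtain c where "y \<noteq> 0" "c \<noteq> 0" "x = c *\<^sub>R y"
      by (auto simp: proportional_iff)
    then show "proportional y x"
      by (auto simp: proportional_iff intro: exI[of _ "inverse c"])
  qed
  show "transp proportional"
    by (rule transpI) (auto simp: proportional_def)
qed

text \<open>
  A point is given by homogeneous coordinates; a line by the homogeneous coordinates of the
  linear form vanishing on it.
\<close>

quotient_type proj_point = "real^3" / partial: proportional
  by (rule part_equivp_proportional)

quotient_type proj_line = "real^3" / partial: proportional
  by (rule part_equivp_proportional)

lift_definition incident :: "proj_point \<Rightarrow> proj_line \<Rightarrow> bool" is "\<lambda>x l. x \<bullet> l = 0"
  by (auto simp: proportional_iff)

definition join :: "proj_point \<Rightarrow> proj_point \<Rightarrow> proj_line" where
  "join A B = (THE g. incident A g \<and> incident B g)"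

definition meet :: "proj_line \<Rightarrow> proj_line \<Rightarrow> proj_point" where
  "meet g h = (THE A. incident A g \<and> incident A h)"

definition collinear_points :: "proj_point \<Rightarrow> proj_point \<Rightarrow> proj_point \<Rightarrow> bool" where
  "collinear_points A B C \<longleftrightarrow> (\<exists>g. incident A g \<and> incident B g \<and> incident C g)"


section \<open>Harmonic pencils\<close>

text \<open>
  For linear forms \<open>g\<close>, \<open>h\<close> vanishing at \<open>x\<close>, the vector \<open>cross3 g h\<close> is a multiple of \<open>x\<close>, so
  \<open>x \<bullet> cross3 g h\<close> is, up to a factor depending only on \<open>x\<close>, the \<open>2 \<times> 2\<close> determinant of the
  coordinates of \<open>g\<close> and \<open>h\<close> in a basis of the forms vanishing at \<open>x\<close>. The quotient below is thus
  the usual cross-ratio \<open>(g h; u v)\<close> of four lines through a point. It is meaningful only for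
  distinct lines through \<open>x\<close>.
\<close>

lift_definition cross_ratio ::
  "proj_point \<Rightarrow> proj_line \<Rightarrow> proj_line \<Rightarrow> proj_line \<Rightarrow> proj_line \<Rightarrow> real" is
  "\<lambda>x g h u v. ((x \<bullet> cross3 g u) * (x \<bullet> cross3 h v)) / ((x \<bullet> cross3 g v) * (x \<bullet> cross3 h u))"
  by (auto simp: proportional_iff cross_mult_left cross_mult_right)

definition harmonic_conjugate ::
  "proj_point \<Rightarrow> proj_line \<Rightarrow> proj_line \<Rightarrow> proj_line \<Rightarrow> proj_line \<Rightarrow> bool" where
  "harmonic_conjugate A g h u v \<longleftrightarrow> cross_ratio A g h u v = -1"

definition harmonic_pencil ::
  "proj_point \<Rightarrow> proj_line \<Rightarrow> proj_line \<Rightarrow> proj_line \<Rightarrow> proj_line \<Rightarrow> bool" where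
  "harmonic_pencil A g h u v \<longleftrightarrow>
     distinct [g, h, u, v] \<and>
     incident A g \<and> incident A h \<and> incident A u \<and> incident A v \<and>
     harmonic_conjugate A g h u v"


section \<open>Joins and meets are well defined\<close>

lemma orthogonal_to_both:
  fixes x y :: "real^3"
  assumes "x \<noteq> 0" "y \<noteq> 0" "\<not> proportional x y"
  shows "\<exists>z. z \<noteq> 0 \<and> x \<bullet> z = 0 \<and> y \<bullet> z = 0"
    and "\<lbrakk>z \<noteq> 0; x \<bullet> z = 0; y \<bullet> z = 0; w \<noteq> 0; x \<bullet> w = 0; y \<bullet> w = 0\<rbrakk> \<Longrightarrow> proportional z w"
proof -
  have nc: "cross3 x y \<noteq> 0"
  proof
    assume "cross3 x y = 0"
    then have "collinear {0, x, y}" by (simp add: cross_eq_0)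
    with assms show False
      by (metis collinear_lemma part_equivp_proportional part_equivp_symp proportional_def)
  qed
  have orth: "x \<bullet> cross3 x y = 0" "y \<bullet> cross3 x y = 0"
    by (simp_all add: dot_cross_self)
  with nc show "\<exists>z. z \<noteq> 0 \<and> x \<bullet> z = 0 \<and> y \<bullet> z = 0" by blast
  have mult: "proportional z (cross3 x y)" if "z \<noteq> 0" "x \<bullet> z = 0" "y \<bullet> z = 0" for z
  proof -
    have "cross3 z (cross3 x y) = 0"
      using that by (simp add: Lagrange inner_commute)
    then have "collinear {0, cross3 x y, z}"
      by (simp add: cross_eq_0 insert_commute)
    then show ?thesis using nc \<open>z \<noteq> 0\<close>
      by (auto simp: collinear_lemma proportional_def)
  qed
  show "\<lbrakk>z \<noteq> 0; x \<bullet> z = 0; y \<bullet> z = 0; w \<noteq> 0; x \<bullet> w = 0; y \<bullet> w = 0\<rbrakk> \<Longrightarrow> proportional z w"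
    using mult part_equivp_proportional by (meson part_equivp_symp part_equivp_transp)
qed

lemma ex1_line:
  assumes "A \<noteq> B"
  shows "\<exists>!g. incident A g \<and> incident B g"
proof (rule ex_ex1I)
  show "\<exists>g. incident A g \<and> incident B g"
    using assms
  proof transfer
    fix x y assume "proportional x x" "proportional y y" "\<not> proportional x y"
    then obtain z where "z \<noteq> 0" "x \<bullet> z = 0" "y \<bullet> z = 0"
      using orthogonal_to_both(1)[of x y] by auto
    then show "\<exists>z\<in>{z. proportional z z}. x \<bullet> z = 0 \<and> y \<bullet> z = 0"
      by auto
  qed
  have "g = h" if "incident A g" "incident B g" "incident A h" "incident B h" for g h
    using assms that
  proof transfer
    fix x y z w
    assume "proportional x x" "proportional y y" "\<not> proportional x y"
      "proportional z z" "x \<bullet> z = 0" "y \<bullet> z = 0"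
      "proportional w w" "x \<bullet> w = 0" "y \<bullet> w = 0"
    then show "proportional z w"
      using orthogonal_to_both(2)[of x y z w] by simp
  qed
  then show "\<And>g h. \<lbrakk>incident A g \<and> incident B g; incident A h \<and> incident B h\<rbrakk> \<Longrightarrow> g = h"
    by blast
qed

lemma ex1_point:
  assumes "g \<noteq> h"
  shows "\<exists>!A. incident A g \<and> incident A h"
proof (rule ex_ex1I)
  show "\<exists>A. incident A g \<and> incident A h"
    using assms
  proof transfer
    fix x y assume "proportional x x" "proportional y y" "\<not> proportional x y"
    then obtain z where "z \<noteq> 0" "x \<bullet> z = 0" "y \<bullet> z = 0"
      using orthogonal_to_both(1)[of x y] by auto
    then show "\<exists>z\<in>{z. proportional z z}. z \<bullet> x = 0 \<and> z \<bullet> y = 0"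
      by (auto simp: inner_commute)
  qed
  have "A = B" if "incident A g" "incident A h" "incident B g" "incident B h" for A B
    using assms that
  proof transfer
    fix x y z w
    assume "proportional x x" "proportional y y" "\<not> proportional x y"
      "proportional z z" "z \<bullet> x = 0" "z \<bullet> y = 0"
      "proportional w w" "w \<bullet> x = 0" "w \<bullet> y = 0"
    then show "proportional z w"
      using orthogonal_to_both(2)[of x y z w] by (simp add: inner_commute)
  qed
  then show "\<And>A B. \<lbrakk>incident A g \<and> incident A h; incident B g \<and> incident B h\<rbrakk> \<Longrightarrow> A = B"
    by blast
qed

end

theory Submission
  imports Defs
begin

text \<open>
  The coordinate vectors of \<open>a\<^sub>i\<close> can be scaled such that the lines \<open>b\<^sub>i\<^sub>1\<close> and \<open>b\<^sub>i\<^sub>2\<close> have the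
  coordinates \<open>a + a\<^sub>i\<close> and \<open>a - a\<^sub>i\<close>. As \<open>(a + a\<^sub>1) - (a + a\<^sub>2) = a\<^sub>1 - a\<^sub>2 = (a - a\<^sub>2) - (a - a\<^sub>1)\<close>, the
  line \<open>a\<^sub>1 - a\<^sub>2\<close> contains the first triple. The second triple is the first one with \<open>b\<^sub>2\<^sub>1\<close> and
  \<open>b\<^sub>2\<^sub>2\<close> exchanged.
\<close>

text \<open>Cramer's rule for expanding \<open>u\<close> in \<open>x\<close>, \<open>v\<close>,
  \<open>w\<close>, cleared of denominators: each triple product is a determinant. As a polynomial
  identity it needs no independence.\<close>

lemma cross3_cramer:
  fixes x u v w :: "real^3"
  shows "(x \<bullet> cross3 v w) *\<^sub>R u =
    (u \<bullet> cross3 v w) *\<^sub>R x + (x \<bullet> cross3 u w) *\<^sub>R v + (x \<bullet> cross3 v u) *\<^sub>R w"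
  by (simp add: vec_eq_iff forall_3 inner_vec_def sum_3 cross3_simps)

text \<open>Pairing Cramer's rule with \<open>x\<close> leaves only the \<open>x\<close> term, so
  its coefficient vanishes. This gives an explicit linear relation between three concurrent
  lines.\<close>

lemma cross3_cramer_orthogonal:
  fixes x u v w :: "real^3"
  assumes "x \<noteq> 0" "x \<bullet> u = 0" "x \<bullet> v = 0" "x \<bullet> w = 0"
  shows "(x \<bullet> cross3 v w) *\<^sub>R u = (x \<bullet> cross3 v u) *\<^sub>R w - (x \<bullet> cross3 w u) *\<^sub>R v"
proof -
  have "x \<bullet> ((x \<bullet> cross3 v w) *\<^sub>R u) = (u \<bullet> cross3 v w) * (x \<bullet> x)"
    using assms by (subst cross3_cramer) (simp add: inner_add_right)
  then have "u \<bullet> cross3 v w = 0"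
    using assms by simp
  then show ?thesis
    using cross3_cramer[of x v w u] cross_skew[of u w] by simp
qed

text \<open>Provides the scaling of coordinates: a cross-ratio of -1 says that the coefficient
  ratios of \<open>u\<close> and \<open>v\<close> in terms of \<open>g\<close> and \<open>h\<close>
  are opposite.\<close>

lemma harmonic_coordinates:
  fixes x g h u v :: "real^3"
  assumes "x \<noteq> 0"
    and orth: "x \<bullet> g = 0" "x \<bullet> h = 0" "x \<bullet> u = 0" "x \<bullet> v = 0"
    and harm: "((x \<bullet> cross3 g u) * (x \<bullet> cross3 h v)) / ((x \<bullet> cross3 g v) * (x \<bullet> cross3 h u)) = -1"
  obtains c k l where "c \<noteq> 0" "g + c *\<^sub>R h = k *\<^sub>R u" "g - c *\<^sub>R h = l *\<^sub>R v"
proof -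
  define d where "d = x \<bullet> cross3 g h"
  define gu gv hu hv where
    "gu = x \<bullet> cross3 g u" "gv = x \<bullet> cross3 g v" "hu = x \<bullet> cross3 h u" "hv = x \<bullet> cross3 h v"
  \<comment> \<open>Division by zero yields 0, so the value -1 excludes a vanishing factor.\<close>
  have nz: "gu \<noteq> 0" "gv \<noteq> 0" "hu \<noteq> 0" "hv \<noteq> 0"
    using harm unfolding gu_gv_hu_hv_def by auto
  have ratio: "gu / hu = - (gv / hv)"
    using harm nz unfolding gu_gv_hu_hv_def[symmetric] by (simp add: field_simps)
  have u: "d *\<^sub>R u = gu *\<^sub>R h - hu *\<^sub>R g" and v: "d *\<^sub>R v = gv *\<^sub>R h - hv *\<^sub>R g"
    unfolding d_def gu_gv_hu_hv_def
    by (rule cross3_cramer_orthogonal[OF assms(1)]; fact orth)+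
  \<comment> \<open>The constant \<open>c\<close> is the \<open>h\<close> coefficient of
    \<open>u\<close> after rescaling its \<open>g\<close> coefficient to 1; by \<open>ratio\<close>,
    the same rescaling of \<open>v\<close> gives \<open>- c\<close>.\<close>
  have "g + (- gu / hu) *\<^sub>R h = (- 1 / hu) *\<^sub>R (gu *\<^sub>R h - hu *\<^sub>R g)"
    using nz by (simp add: algebra_simps)
  also have "\<dots> = (- d / hu) *\<^sub>R u"
    unfolding u[symmetric] by simp
  finally have 1: "g + (- gu / hu) *\<^sub>R h = (- d / hu) *\<^sub>R u" .
  have "g - (- gu / hu) *\<^sub>R h = (- 1 / hv) *\<^sub>R (gv *\<^sub>R h - hv *\<^sub>R g)"
    using nz ratio by (simp add: algebra_simps)
  also have "\<dots> = (- d / hv) *\<^sub>R v"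
    unfolding v[symmetric] by simp
  finally have 2: "g - (- gu / hu) *\<^sub>R h = (- d / hv) *\<^sub>R v" .
  show thesis
    by (rule that[OF _ 1 2]) (use nz in simp)
qed

text \<open>Exchanging \<open>u\<close> and \<open>v\<close> inverts the cross-ratio, and -1 is its
  own inverse.\<close>

lemma harmonic_pencil_swap:
  assumes "harmonic_pencil A g h u v"
  shows "harmonic_pencil A g h v u"
proof -
  have "cross_ratio A g h v u = inverse (cross_ratio A g h u v)"
    by transfer simp
  with assms show ?thesis
    by (auto simp: harmonic_pencil_def harmonic_conjugate_def)
qed

text \<open>Describing the points by incidence instead of \<open>meet\<close> lets the claim
  transfer directly to coordinate vectors.\<close>

lemma harmonic_pencils_collinear:
  assumes "harmonic_pencil A g h u v" "harmonic_pencil B g h' u' v'" "h \<noteq> h'"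
    and "incident P h" "incident P h'" "incident Q u" "incident Q u'" "incident R v" "incident R v'"
  shows "collinear_points P Q R"
proof -
  have "incident A g" "incident A h" "incident A u" "incident A v"
    "cross_ratio A g h u v = -1"
    "incident B g" "incident B h'" "incident B u'" "incident B v'"
    "cross_ratio B g h' u' v' = -1"
    using assms(1,2) by (auto simp: harmonic_pencil_def harmonic_conjugate_def)
  with assms(3-) show ?thesis
    unfolding collinear_points_def
  proof transfer
    fix h h' p q u u' r v v' g x y :: "real^3"
    assume reps: "proportional h h" "proportional h' h'" "proportional g g"
        "proportional x x" "proportional y y"
      and neq: "\<not> proportional h h'"
      and x: "x \<bullet> g = 0" "x \<bullet> h = 0" "x \<bullet> u = 0" "x \<bullet> v = 0"
        "x \<bullet> cross3 g u * (x \<bullet> cross3 h v) / (x \<bullet> cross3 g v * (x \<bullet> cross3 h u)) = -1"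
      and y: "y \<bullet> g = 0" "y \<bullet> h' = 0" "y \<bullet> u' = 0" "y \<bullet> v' = 0"
        "y \<bullet> cross3 g u' * (y \<bullet> cross3 h' v') / (y \<bullet> cross3 g v' * (y \<bullet> cross3 h' u')) = -1"
      and p: "p \<bullet> h = 0" "p \<bullet> h' = 0"
      and q: "q \<bullet> u = 0" "q \<bullet> u' = 0"
      and r: "r \<bullet> v = 0" "r \<bullet> v' = 0"
    obtain c k l where c: "c \<noteq> 0" "g + c *\<^sub>R h = k *\<^sub>R u" "g - c *\<^sub>R h = l *\<^sub>R v"
      using harmonic_coordinates[OF _ x] reps unfolding proportional_refl by metis
    obtain c' k' l' where c': "g + c' *\<^sub>R h' = k' *\<^sub>R u'" "g - c' *\<^sub>R h' = l' *\<^sub>R v'"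
      using harmonic_coordinates[OF _ y] reps unfolding proportional_refl by metis
    \<comment> \<open>The common line: the shared \<open>g\<close> cancels when the two sums, or the
      two differences, are subtracted from each other, so \<open>m\<close> combines \<open>u\<close>
      with \<open>u'\<close> and also \<open>v\<close> with \<open>v'\<close>.\<close>
    define m where "m = c *\<^sub>R h - c' *\<^sub>R h'"
    have "m \<noteq> 0"
    proof
      assume "m = 0"
      then have "h = (c' / c) *\<^sub>R h'"
        using c(1) by (simp add: m_def eq_vector_fraction_iff)
      with reps neq show False
        unfolding proportional_def by blast
    qed
    moreover have "p \<bullet> m = 0"
      using p by (simp add: m_def inner_diff_right)
    moreover have "m = k *\<^sub>R u - k' *\<^sub>R u'"
      unfolding m_def c(2)[symmetric] c'(1)[symmetric] by simp
    then have "q \<bullet> m = 0"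
      using q by (simp add: inner_diff_right)
    moreover have "m = l' *\<^sub>R v' - l *\<^sub>R v"
      unfolding m_def c(3)[symmetric] c'(2)[symmetric] by simp
    then have "r \<bullet> m = 0"
      using r by (simp add: inner_diff_right)
    ultimately show "\<exists>m\<in>{m. proportional m m}. p \<bullet> m = 0 \<and> q \<bullet> m = 0 \<and> r \<bullet> m = 0"
      by auto
  qed
qed

lemma incident_meet:
  assumes "g \<noteq> h"
  shows "incident (meet g h) g" "incident (meet g h) h"
  using theI'[OF ex1_point[OF assms]] by (auto simp: meet_def)

theorem corollary2:
  fixes A1 A2 :: proj_point
    and a a1 a2 b11 b12 b21 b22 :: proj_line
  assumes "A1 \<noteq> A2"
    and "a = join A1 A2"
    and "harmonic_pencil A1 a a1 b11 b12"
    and "harmonic_pencil A2 a a2 b21 b22"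
  shows "collinear_points (meet a1 a2) (meet b11 b21) (meet b12 b22) \<and>
         collinear_points (meet a1 a2) (meet b11 b22) (meet b12 b21)"
proof -
  have inc: "a \<noteq> a1" "a \<noteq> b11" "a \<noteq> b12"
    "incident A1 a" "incident A1 a1" "incident A1 b11" "incident A1 b12"
    "incident A2 a" "incident A2 a2" "incident A2 b21" "incident A2 b22"
    using assms(3,4) by (auto simp: harmonic_pencil_def)
  \<comment> \<open>If \<open>l\<close> and \<open>m\<close> coincided, this line would pass through
    both points and hence be \<open>a\<close>. This makes all the meets well defined.\<close>
  have neq: "l \<noteq> m" if "incident A1 l" "incident A2 m" "a \<noteq> l" for l m
    using that inc ex1_line[OF assms(1)] by metis
  \<comment> \<open>Keeping \<open>u\<close> and \<open>v\<close> general covers both orders of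
    \<open>b21\<close> and \<open>b22\<close>.\<close>
  have *: "collinear_points (meet a1 a2) (meet b11 u) (meet b12 v)"
    if "harmonic_pencil A2 a a2 u v" for u v
  proof (rule harmonic_pencils_collinear[OF assms(3) that])
    have "incident A2 u" "incident A2 v"
      using that by (auto simp: harmonic_pencil_def)
    then have "a1 \<noteq> a2" "b11 \<noteq> u" "b12 \<noteq> v"
      using neq inc by simp_all
    then show "a1 \<noteq> a2"
      "incident (meet a1 a2) a1" "incident (meet a1 a2) a2"
      "incident (meet b11 u) b11" "incident (meet b11 u) u"
      "incident (meet b12 v) b12" "incident (meet b12 v) v"
      by (simp_all add: incident_meet)
  qed
  show ?thesis
    using *[OF assms(4)] *[OF harmonic_pencil_swap[OF assms(4)]] by simp
qed

end
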